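(* For every integer $n\ge 5$ there exists a family $\mathcal F$ of $n$ axis-parallel rectangles such that $\pi_L(\mathcal F)\ge \frac{6}{5}\,\pi(\mathcal F)$.
   Context: For a finite family $\mathcal F$ of closed axis-parallel rectangles in the plane, a point set $P\subset\mathbb R^2$ is $\mathcal F$-piercing if every translate of every rectangle in $\mathcal F$ contains a point of $P$. The density of a point set $P$ is $\limsup_{r\to\infty} |P\cap[-r,r]^2|/(2r)^2$. $\pi(\mathcal F)$ is the infimum of the densities of $\mathcal F$-piercing point sets, and $\pi_L(\mathcal F)$ is the infimum of the densities of $\mathcal F$-piercing lattices, where a lattice $\{iu+jv:i,j\in\mathbb Z\}$ ($u,v$ linearly independent) has density $1/|\det[u,v]|$. *)

theory Defs
  imports "HOL-Analysis.Analysis"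
begin

text \<open>A closed axis-parallel rectangle is represented (up to translation) by its
 dimensions (w,h) with w>0, h>0. The translate by (a,b) is [a,a+w] x [b,b+h].\<close>

definition rect_translate :: "real \<times> real \<Rightarrow> real \<times> real \<Rightarrow> (real \<times> real) set" where
  "rect_translate R t = {p. fst t \<le> fst p \<and> fst p \<le> fst t + fst R \<and>
                            snd t \<le> snd p \<and> snd p \<le> snd t + snd R}"

definition is_rect :: "real \<times> real \<Rightarrow> bool" where
  "is_rect R \<longleftrightarrow> fst R > 0 \<and> snd R > 0"

definition piercing :: "(real \<times> real) set \<Rightarrow> (real \<times> real) set \<Rightarrow> bool" where
  "piercing F P \<longleftrightarrow> (\<forall>R\<in>F. \<forall>t. \<exists>p\<in>P. p \<in> rect_translate R t)"

definition ecard :: "'a set \<Rightarrow> ereal" where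
  "ecard A = (if finite A then ereal (real (card A)) else \<infinity>)"

definition density :: "(real \<times> real) set \<Rightarrow> ereal" where
  "density P = Limsup at_top (\<lambda>r::real. ecard (P \<inter> ({-r..r} \<times> {-r..r})) / ereal ((2*r)^2))"

definition pi_dens :: "(real \<times> real) set \<Rightarrow> ereal" where
  "pi_dens F = Inf {density P | P. piercing F P}"

definition lattice :: "real \<times> real \<Rightarrow> real \<times> real \<Rightarrow> (real \<times> real) set" where
  "lattice u v = {of_int i *\<^sub>R u + of_int j *\<^sub>R v | i j. True}"

definition det2 :: "real \<times> real \<Rightarrow> real \<times> real \<Rightarrow> real" where
  "det2 u v = fst u * snd v - snd u * fst v"

definition pi_lat :: "(real \<times> real) set \<Rightarrow> ereal" where
  "pi_lat F = Inf {ereal (1 / \<bar>det2 u v\<bar>) | u v. det2 u v \<noteq> 0 \<and> piercing F (lattice u v)}"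

end

theory Submission
  imports Defs "HOL-Real_Asymp.Real_Asymp"
begin

text \<open>The rectangles \<open>1\<times>6\<close>, \<open>2\<times>4\<close>, \<open>4\<times>2\<close>, \<open>6\<times>1\<close> are all pierced by the integer
  points \<open>(x, y)\<close> with \<open>y mod 6 = \<sigma> (x mod 6)\<close>, for a cyclic arrangement \<open>\<sigma>\<close> of the residues
  modulo 6 in which neighbours never differ by 1; this set has density \<open>1/6\<close>. A lattice of
  determinant 6 cannot imitate it because \<open>1\<close> and \<open>-1\<close> are the only units modulo 6, and the best
  lattice has determinant 5. To see this, note that a basis \<open>(a, b), (c, -d)\<close> with nonnegative
  \<open>a, b, c, d\<close> yields the open box \<open>(0, a + c) \<times> (-d, b)\<close> without lattice points, so that
  \<open>a + c \<le> w\<close> or \<open>b + d \<le> h\<close> for each pierced rectangle \<open>w\<times>h\<close>. Subtractive Euclidean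
  steps on \<open>(b, d)\<close> give a chain of such bases with ever wider and flatter boxes. Starting from a
  basis with \<open>a + c \<le> 1\<close> and \<open>b, d \<le> 6\<close>, at most five steps contradict \<open>ad + bc > 5\<close>. Families
  of more rectangles arise by adding rectangles that contain \<open>6\<times>1\<close>.\<close>

section \<open>Bases of a lattice and empty boxes\<close>

lemma lattice_swap: "lattice u v = lattice v u"
  unfolding lattice_def by (auto simp: add.commute) (metis add.commute)+

lemma lattice_uminus: "lattice u v \<subseteq> lattice u (-v)"
proof
  fix p assume "p \<in> lattice u v"
  then obtain i j where p: "p = of_int i *\<^sub>R u + of_int j *\<^sub>R v"
    by (auto simp: lattice_def)
  have "p = of_int i *\<^sub>R u + of_int (-j) *\<^sub>R (-v)" by (simp add: p)
  then show "p \<in> lattice u (-v)" unfolding lattice_def by blast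
qed

lemma lattice_shear: "lattice u v \<subseteq> lattice (u + of_int k *\<^sub>R v) v"
proof
  fix p assume "p \<in> lattice u v"
  then obtain i j where p: "p = of_int i *\<^sub>R u + of_int j *\<^sub>R v"
    by (auto simp: lattice_def)
  have "p = of_int i *\<^sub>R (u + of_int k *\<^sub>R v) + of_int (j - i * k) *\<^sub>R v"
    by (simp add: p algebra_simps)
  then show "p \<in> lattice (u + of_int k *\<^sub>R v) v" unfolding lattice_def by blast
qed

text \<open>The sign \<open>s\<close> makes the predicate invariant under reflection in the \<open>x\<close>-axis,
  so that the two basis vectors play symmetric roles.\<close>

definition quad_basis ::
    "(real \<times> real) set \<Rightarrow> real \<Rightarrow> real \<Rightarrow> real \<Rightarrow> real \<Rightarrow> real \<Rightarrow> bool" where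
  "quad_basis L D a b c d \<longleftrightarrow> 0 \<le> a \<and> 0 \<le> b \<and> 0 \<le> c \<and> 0 \<le> d \<and> a * d + b * c = D \<and>
     (\<exists>s\<in>{1, -1}. L \<subseteq> lattice (a, s * b) (c, - s * d))"

lemma quad_basis_swap:
  assumes "quad_basis L D a b c d"
  shows "quad_basis L D c d a b"
proof -
  obtain s where s: "s \<in> {1, -1}" "L \<subseteq> lattice (a, s * b) (c, - s * d)"
    using assms unfolding quad_basis_def by blast
  have "L \<subseteq> lattice (c, (-s) * d) (a, - (-s) * b)"
    using s(2) by (subst lattice_swap) simp
  moreover have "-s \<in> {1, -1}" using s(1) by auto
  ultimately show ?thesis
    using assms unfolding quad_basis_def by (auto simp: algebra_simps)
qed

lemma quad_basis_shear:
  assumes "quad_basis L D a b c d" "0 \<le> a + of_int k * c" "0 \<le> b - of_int k * d"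
  shows "quad_basis L D (a + of_int k * c) (b - of_int k * d) c d"
proof -
  obtain s where s: "s \<in> {1, -1}" "L \<subseteq> lattice (a, s * b) (c, - s * d)"
    using assms unfolding quad_basis_def by blast
  have "L \<subseteq> lattice (a + of_int k * c, s * (b - of_int k * d)) (c, - s * d)"
    using s(2) lattice_shear[of "(a, s * b)" "(c, - s * d)" k]
    by (simp add: algebra_simps)
  then show ?thesis
    using assms s(1) unfolding quad_basis_def by (auto simp: algebra_simps)
qed

text \<open>For \<open>s = 1\<close> no lattice point lies in the open box (0, a + c) x (-d, b):
  coefficients that are both at least 1 or both at most 0 violate the x-range, mixed ones the
  y-range. For this it suffices that \<open>L\<close> is contained in the spanned lattice.\<close>

lemma quad_basis_empty_box:
  assumes "quad_basis L D a b c d" and "piercing F L" and "(w, h) \<in> F"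
  shows "a + c \<le> w \<or> b + d \<le> h"
proof (rule ccontr)
  assume "\<not> ?thesis"
  then have wh: "w < a + c" "h < b + d" by auto
  obtain s where s: "s \<in> {1, -1}" "L \<subseteq> lattice (a, s * b) (c, - s * d)"
    using assms unfolding quad_basis_def by blast
  have nn: "0 \<le> a" "0 \<le> b" "0 \<le> c" "0 \<le> d" using assms by (auto simp: quad_basis_def)
  \<comment> \<open>The rectangle is centred in the empty box, which for \<open>s = -1\<close> is
    the mirror image (0, a + c) x (-b, d).\<close>
  define m where "m = (b + d - h) / 2"
  define t where "t = ((a + c - w) / 2, if s = 1 then m - d else m - b)"
  obtain p where p: "p \<in> L" "p \<in> rect_translate (w, h) t"
    using assms(2,3) unfolding piercing_def by blast
  obtain i j :: int where ij: "p = of_int i *\<^sub>R (a, s * b) + of_int j *\<^sub>R (c, - s * d)"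
    using p(1) s(2) by (auto simp: lattice_def)
  have x: "0 < i * a + j * c" "i * a + j * c < a + c"
    using p(2) wh by (auto simp: rect_translate_def t_def ij field_simps)
  have y: "- d < i * b - j * d" "i * b - j * d < b"
    using p(2) wh s(1) by (auto simp: rect_translate_def t_def m_def ij field_simps)
  consider "i \<ge> 1" "j \<ge> 1" | "i \<ge> 1" "j \<le> 0" | "i \<le> 0" "j \<ge> 1" | "i \<le> 0" "j \<le> 0"
    by linarith
  then show False
  proof cases
    case 1
    have "1 * a \<le> i * a" "1 * c \<le> j * c"
      using 1 nn by (intro mult_right_mono; simp)+
    then show False using x by simp
  next
    case 2
    have "1 * b \<le> i * b" "j * d \<le> 0"
      using 2 nn by (intro mult_right_mono mult_nonpos_nonneg; simp)+
    then show False using y by simp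
  next
    case 3
    have "i * b \<le> 0" "1 * d \<le> j * d"
      using 3 nn by (intro mult_right_mono mult_nonpos_nonneg; simp)+
    then show False using y by simp
  next
    case 4
    have "i * a \<le> 0" "j * c \<le> 0"
      using 4 nn by (intro mult_nonpos_nonneg; simp)+
    then show False using x by simp
  qed
qed


section \<open>Existence of bases by Euclid's algorithm\<close>

lemma quad_basis_mono: "quad_basis L D a b c d \<Longrightarrow> L' \<subseteq> L \<Longrightarrow> quad_basis L' D a b c d"
  by (auto simp: quad_basis_def)

text \<open>Reducing the second vector modulo the first gives 0 \<le> q < y. If then p \<le> 0 or p
  \<ge> x, negating the vector or first subtracting the other one once more yields opposite slopes;
  q = 0 is already of that form.\<close>

lemma euclid_step:
  fixes x y x' y' s :: real
  assumes "x > 0" "y > 0" and s: "s \<in> {1, -1}"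
  defines "L \<equiv> lattice (x, s * y) (x', s * y')" and "D \<equiv> \<bar>x * y' - y * x'\<bar>"
  obtains a b c d where "a > 0" "b > 0" "quad_basis L D a b c d"
  | p q where "0 < p" "p < x" "0 < q" "q < y" "L \<subseteq> lattice (x, s * y) (p, s * q)"
      "D = \<bar>x * q - y * p\<bar>"
proof -
  define k where "k = \<lfloor>y' / y\<rfloor>"
  define p where "p = x' - of_int k * x"
  define q where "q = y' - of_int k * y"
  have "of_int k \<le> y' / y" "y' / y < of_int k + 1" unfolding k_def by linarith+
  then have q: "0 \<le> q" "q < y" using \<open>y > 0\<close> by (auto simp: q_def field_simps)
  have L: "L \<subseteq> lattice (x, s * y) (p, s * q)"
    using lattice_shear[of "(x', s * y')" "(x, s * y)" "-k"] lattice_swap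
    unfolding L_def p_def q_def by (simp add: algebra_simps)
  have D: "D = \<bar>x * q - y * p\<bar>" by (simp add: D_def p_def q_def algebra_simps)
  consider "p \<le> 0" | "p \<ge> x" | "0 < p" "q = 0" | "0 < p" "p < x" "0 < q"
    using q by linarith
  then show thesis
  proof cases
    case 1
    have "L \<subseteq> lattice (x, s * y) (-p, - s * q)"
      using L lattice_uminus[of "(x, s * y)" "(p, s * q)"] by simp
    moreover have "0 \<le> x * q" "y * p \<le> 0"
      using 1 q assms(1,2) by (auto intro: mult_nonneg_nonpos)
    then have "D = x * q + y * (-p)" by (simp add: D)
    ultimately have "quad_basis L D x y (-p) q"
      using 1 q assms(1-3) by (auto simp: quad_basis_def)
    then show thesis using that(1) assms(1,2) by blast
  next
    case 2
    have "L \<subseteq> lattice (x, s * y) (p - x, - s * (y - q))"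
      using L lattice_shear[of "(p, s * q)" "(x, s * y)" "-1"] lattice_swap
      by (simp add: algebra_simps)
    moreover have "y * x \<le> y * p" "x * q \<le> x * y"
      using 2 q assms(1,2) by (intro mult_left_mono; simp)+
    then have "D = x * (y - q) + y * (p - x)"
      by (simp add: D algebra_simps)
    ultimately have "quad_basis L D x y (p - x) (y - q)"
      using 2 q assms(1-3) by (auto simp: quad_basis_def)
    then show thesis using that(1) assms(1,2) by blast
  next
    case 3
    then have "quad_basis L D x y p 0"
      using L assms(1-3) by (auto simp: quad_basis_def D)
    then show thesis using that(1) assms(1,2) by blast
  next
    case 4
    then show thesis using that(2) q L D by blast
  qed
qed

text \<open>Euclid's algorithm: as long as the second vector, reduced modulo the first one, lies
  strictly inside the box spanned by the first one, it cuts this box into four parts, and one of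
  the two parts on the diagonal has at most half of the area. The area cannot fall below the
  determinant.\<close>

lemma quad_basis_exists_aux:
  fixes x y x' y' s :: real
  assumes "x > 0" "y > 0" and "x * y < 2 ^ n * \<bar>x * y' - y * x'\<bar>" and s: "s \<in> {1, -1}"
  shows "\<exists>a b c d. a > 0 \<and> b > 0 \<and>
    quad_basis (lattice (x, s * y) (x', s * y')) \<bar>x * y' - y * x'\<bar> a b c d"
  using assms(1-3)
proof (induction n arbitrary: x y x' y')
  case (0 x y x' y')
  from 0(1,2) s show ?case
  proof (rule euclid_step[of x y s x' y'], goal_cases)
    case (2 p q)
    \<comment> \<open>Both products lie strictly between 0 and \<open>x * y\<close>, so their
      difference cannot reach the determinant assumed for exponent 0.\<close>
    have "x * q < x * y" "0 < x * q" "y * p < x * y" "0 < y * p"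
      using 0 2 by (auto simp: mult.commute)
    then show ?case using 0(3) 2(6) by auto
  qed auto
next
  case (Suc n x y x' y')
  let ?L = "lattice (x, s * y) (x', s * y')" and ?D = "\<bar>x * y' - y * x'\<bar>"
  from Suc.prems(1,2) s show ?case
  proof (rule euclid_step[of x y s x' y'], goal_cases)
    case (2 p q)
    have cross: "0 \<le> p * (y - q)" "0 \<le> (x - p) * q"
      using 2 by auto
    have "p * q \<le> x * y / 2 \<or> (x - p) * (y - q) \<le> x * y / 2"
      using cross by (auto simp: algebra_simps)
    then show ?case
    proof
      assume "p * q \<le> x * y / 2"
      then have "p * q < 2 ^ n * ?D" using Suc.prems(3) by simp
      moreover have "?D = \<bar>p * y - q * x\<bar>"
        unfolding 2(6) by (simp add: mult.commute abs_minus_commute)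
      moreover have "?L \<subseteq> lattice (p, s * q) (x, s * y)"
        using 2(5) lattice_swap by simp
      ultimately show ?thesis
        using Suc.IH[of p q y x] 2(1,3) quad_basis_mono by metis
    next
      assume "(x - p) * (y - q) \<le> x * y / 2"
      then have "(x - p) * (y - q) < 2 ^ n * ?D" using Suc.prems(3) by simp
      moreover have D: "?D = \<bar>(x - p) * q - (y - q) * p\<bar>"
        unfolding 2(6) by (simp add: algebra_simps)
      moreover have "?L \<subseteq> lattice (x - p, s * (y - q)) (p, s * q)"
        using 2(5) lattice_shear[of "(x, s * y)" "(p, s * q)" "-1"]
        by (simp add: algebra_simps)
      ultimately show ?thesis
        using Suc.IH[of "x - p" "y - q" q p] 2 quad_basis_mono by (metis diff_gt_0_iff_gt)
    qed
  qed auto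
qed

text \<open>The extra conditions in the axis-parallel cases let the iterations along the chain of
  bases start.\<close>

lemma quad_basis_exists:
  assumes "det2 u v \<noteq> 0"
  obtains a b c d where "quad_basis (lattice u v) \<bar>det2 u v\<bar> a b c d" "a > 0" "b > 0"
    "c = 0 \<Longrightarrow> b \<le> d" "d = 0 \<Longrightarrow> a \<le> c"
proof -
  have nonaxis: "\<exists>a b c d. a > 0 \<and> b > 0 \<and> quad_basis (lattice u v) \<bar>det2 u v\<bar> a b c d"
    if nz: "det2 u v \<noteq> 0" "fst u \<noteq> 0" "snd u \<noteq> 0" for u v
  proof -
    obtain x y x' y' where uv: "u = (x, y)" "v = (x', y')" by (cases u, cases v)
    \<comment> \<open>With this sign, \<open>(\<bar>x\<bar>, s * \<bar>y\<bar>)\<close> is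
      \<open>sgn x\<close> times \<open>u\<close>. The second vector is scaled by
      \<open>sgn x\<close> too, its ordinate being written with a factor s * s = 1.\<close>
    define s where "s = sgn x * sgn y"
    define D where "D = \<bar>\<bar>x\<bar> * (s * (sgn x * y')) - \<bar>y\<bar> * (sgn x * x')\<bar>"
    have s: "s \<in> {1, -1}" using nz by (auto simp: s_def uv sgn_if)
    have D: "D = \<bar>det2 u v\<bar>"
      using nz by (auto simp: D_def s_def uv det2_def sgn_if abs_if algebra_simps split: if_splits)
    have "D > 0" using D nz by simp
    obtain n :: nat where "\<bar>x\<bar> * \<bar>y\<bar> / D < 2 ^ n"
      using real_arch_pow[of 2] by auto
    then have "\<bar>x\<bar> * \<bar>y\<bar> < 2 ^ n * D"
      using \<open>D > 0\<close> by (simp add: field_simps)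
    then have "\<exists>a b c d. a > 0 \<and> b > 0 \<and>
        quad_basis (lattice (\<bar>x\<bar>, s * \<bar>y\<bar>) (sgn x * x', s * (s * (sgn x * y')))) D a b c d"
      using quad_basis_exists_aux[of "\<bar>x\<bar>" "\<bar>y\<bar>" n "s * (sgn x * y')" "sgn x * x'" s] nz s
      unfolding D_def uv by auto
    moreover have "lattice u v \<subseteq> lattice (\<bar>x\<bar>, s * \<bar>y\<bar>) (sgn x * x', s * (s * (sgn x * y')))"
    proof -
      consider "x > 0" | "x < 0" using nz(2) uv(1) by force
      then show ?thesis
      proof cases
        case 1
        then show ?thesis using nz by (auto simp: s_def uv sgn_if)
      next
        case 2
        have "lattice u v \<subseteq> lattice (-u) (-v)"
          using lattice_uminus lattice_swap by blast
        then show ?thesis using nz 2 by (auto simp: s_def uv sgn_if)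
      qed
    qed
    ultimately show ?thesis using quad_basis_mono D by blast
  qed
  have "\<exists>a b c d. a > 0 \<and> b > 0 \<and> quad_basis (lattice u v) \<bar>det2 u v\<bar> a b c d"
  proof -
    \<comment> \<open>If both vectors lie on coordinate axes, independence puts them on different
      axes, and their sum lies on neither.\<close>
    consider "fst u \<noteq> 0 \<and> snd u \<noteq> 0" | "fst v \<noteq> 0 \<and> snd v \<noteq> 0"
      | "fst (u + v) \<noteq> 0 \<and> snd (u + v) \<noteq> 0"
      using assms unfolding det2_def
      by (cases "fst u = 0"; cases "snd u = 0"; cases "fst v = 0"; cases "snd v = 0") simp_all
    then show ?thesis
    proof cases
      case 1
      then show ?thesis using nonaxis assms by blast
    next
      case 2
      moreover have "\<bar>det2 v u\<bar> = \<bar>det2 u v\<bar>" by (simp add: det2_def algebra_simps)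
      ultimately show ?thesis using nonaxis[of v u] assms lattice_swap[of u v] by auto
    next
      case 3
      moreover have "det2 (u + v) v = det2 u v" by (simp add: det2_def algebra_simps)
      moreover have "lattice u v \<subseteq> lattice (u + v) v" using lattice_shear[of u v 1] by simp
      ultimately show ?thesis using nonaxis[of "u + v" v] assms quad_basis_mono by metis
    qed
  qed
  then obtain a b c d where Q: "quad_basis (lattice u v) \<bar>det2 u v\<bar> a b c d" and ab: "a > 0" "b > 0"
    by blast
  then have nn: "c \<ge> 0" "d \<ge> 0" "a * d + b * c > 0" using assms by (auto simp: quad_basis_def)
  consider "c = 0" "d > 0" | "d = 0" "c > 0" | "c > 0" "d > 0"
    using nn by force
  then show thesis
  proof cases
    case 1
    \<comment> \<open>The second vector is vertical. A ceiling minus one, instead of a floor, leaves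
      a remainder in (0, d], so the first height stays positive.\<close>
    define k where "k = \<lceil>b / d\<rceil> - 1"
    have "of_int k < b / d" "b / d \<le> of_int k + 1" unfolding k_def by linarith+
    then have "0 < b - of_int k * d" "b - of_int k * d \<le> d"
      using \<open>d > 0\<close> by (auto simp: field_simps)
    then show thesis using that[OF quad_basis_shear[OF Q, of k]] 1 ab by auto
  next
    case 2
    define k where "k = 1 - \<lceil>a / c\<rceil>"
    have "of_int (-k) < a / c" "a / c \<le> of_int (-k) + 1" unfolding k_def by linarith+
    then have "0 < a + of_int k * c" "a + of_int k * c \<le> c"
      using \<open>c > 0\<close> by (auto simp: field_simps)
    then show thesis using that[OF quad_basis_shear[OF Q, of k]] 2 ab by auto
  next
    case 3
    then show thesis using that[OF Q] ab by auto
  qed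
qed


section \<open>The determinant bound\<close>

text \<open>Reduces the geometry to inequalities between four numbers: \<open>forward\<close> trades
  height of the empty box for width, \<open>backward\<close> does the reverse, and the last four
  assumptions record the pierced rectangles.\<close>

locale quad_chain =
  fixes Q :: "real \<Rightarrow> real \<Rightarrow> real \<Rightarrow> real \<Rightarrow> bool" and D :: real
  assumes nonneg: "Q a b c d \<Longrightarrow> 0 \<le> a \<and> 0 \<le> b \<and> 0 \<le> c \<and> 0 \<le> d"
    and det: "Q a b c d \<Longrightarrow> a * d + b * c = D"
    and swap: "Q a b c d \<Longrightarrow> Q c d a b"
    and forward: "Q a b c d \<Longrightarrow> d \<le> b \<Longrightarrow> Q (a + c) (b - d) c d"
    and backward: "Q a b c d \<Longrightarrow> c \<le> a \<Longrightarrow> Q (a - c) (b + d) c d"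
    and box_1_6: "Q a b c d \<Longrightarrow> a + c \<le> 1 \<or> b + d \<le> 6"
    and box_2_4: "Q a b c d \<Longrightarrow> a + c \<le> 2 \<or> b + d \<le> 4"
    and box_4_2: "Q a b c d \<Longrightarrow> a + c \<le> 4 \<or> b + d \<le> 2"
    and box_6_1: "Q a b c d \<Longrightarrow> a + c \<le> 6 \<or> b + d \<le> 1"
begin

lemma forward': "Q a b c d \<Longrightarrow> b \<le> d \<Longrightarrow> Q a b (a + c) (d - b)"
  using swap[OF forward[OF swap]] by (simp add: add.commute)

lemma backward': "Q a b c d \<Longrightarrow> a \<le> c \<Longrightarrow> Q a b (c - a) (b + d)"
  using swap[OF backward[OF swap]] by (simp add: add.commute)

text \<open>The place where the chain of boxes crosses height 6. The heights are bounded separately,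
  since their sum may still exceed 6 there.\<close>

definition narrow :: bool where
  "narrow \<longleftrightarrow> (\<exists>a b c d. Q a b c d \<and> a + c \<le> 1 \<and> b \<le> 6 \<and> d \<le> 6)"

lemma narrowI: "Q a b c d \<Longrightarrow> a + c \<le> 1 \<Longrightarrow> b \<le> 6 \<Longrightarrow> d \<le> 6 \<Longrightarrow> narrow"
  unfolding narrow_def by blast

text \<open>While the larger height exceeds 6, subtracting the smaller one from it keeps their sum
  above 6, so the width stays at most 1. Each step adds at least \<open>min a c\<close> to the
  width, so this must stop.\<close>

lemma narrow_by_forward:
  assumes "Q a b c d" "b + d > 6" "a > 0" "c > 0"
  shows narrow
proof -
  define e where "e = min a c"
  have "e > 0" using assms by (simp add: e_def)
  obtain n :: nat where "1 / e < n" using reals_Archimedean2 by blast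
  then have "1 < n * e" using \<open>e > 0\<close> by (simp add: field_simps)
  then have "1 < a + c + n * e" using assms by simp
  moreover have "e \<le> a" "e \<le> c" by (auto simp: e_def)
  ultimately show ?thesis using assms(1,2)
  proof (induction n arbitrary: a b c d)
    case 0
    then show ?case using box_1_6[of a b c d] by auto
  next
    case (Suc n)
    have ac: "a + c \<le> 1" using box_1_6 Suc.prems by fastforce
    have grow: "1 < a + c + (e + n * e)" using Suc.prems(1) by (simp add: algebra_simps)
    consider "b \<le> 6" "d \<le> 6" | "d \<le> b" "b > 6" | "b \<le> d" "d > 6" by linarith
    then show ?case
    proof cases
      case 1
      then show ?thesis using narrowI Suc.prems ac by blast
    next
      case 2
      show ?thesis
        by (rule Suc.IH[OF _ _ _ forward[OF Suc.prems(4)]])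
          (use 2 grow Suc.prems \<open>e > 0\<close> in auto)
    next
      case 3
      show ?thesis
        by (rule Suc.IH[OF _ _ _ forward'[OF Suc.prems(4)]])
          (use 3 grow Suc.prems \<open>e > 0\<close> in auto)
    qed
  qed
qed

text \<open>Each step adds at least \<open>min b d\<close> to the sum of the heights. When the sum
  first exceeds 6, the width is at most 1, and the new heights, an old height and the old sum, are
  at most 6.\<close>

lemma narrow_by_backward:
  assumes "Q a b c d" "b + d \<le> 6" "b > 0" "d > 0"
  shows narrow
proof -
  define e where "e = min b d"
  have "e > 0" using assms by (simp add: e_def)
  obtain n :: nat where "6 / e < n" using reals_Archimedean2 by blast
  then have "6 < n * e" using \<open>e > 0\<close> by (simp add: field_simps)
  then have "6 < b + d + n * e" using assms by simp
  moreover have "e \<le> b" "e \<le> d" by (auto simp: e_def)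
  ultimately show ?thesis using assms(1,2)
  proof (induction n arbitrary: a b c d)
    case 0
    then show ?case by auto
  next
    case (Suc n)
    have grow: "6 < b + d + (e + n * e)" using Suc.prems(1) by (simp add: algebra_simps)
    have small: "b \<le> 6" "d \<le> 6" using Suc.prems \<open>e > 0\<close> by linarith+
    consider "c \<le> a" | "a \<le> c" by linarith
    then show ?case
    proof cases
      case 1
      note Q' = backward[OF Suc.prems(4) 1]
      show ?thesis
      proof (cases "b + d + d \<le> 6")
        case True
        show ?thesis
          by (rule Suc.IH[OF _ _ _ Q']) (use True grow Suc.prems \<open>e > 0\<close> in auto)
      next
        case False
        then show ?thesis using narrowI[OF Q'] box_1_6[OF Q'] Suc.prems(5) small by auto
      qed
    next
      case 2
      note Q' = backward'[OF Suc.prems(4) 2]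
      show ?thesis
      proof (cases "b + (b + d) \<le> 6")
        case True
        show ?thesis
          by (rule Suc.IH[OF _ _ _ Q']) (use True grow Suc.prems \<open>e > 0\<close> in auto)
      next
        case False
        then show ?thesis using narrowI[OF Q'] box_1_6[OF Q'] Suc.prems(5) small by auto
      qed
    qed
  qed
qed

text \<open>The side of height 6 on which the box starts decides the direction. A zero increment
  would stall the growth; one initial step removes it, unless a narrow basis is already at
  hand.\<close>

lemma narrow_exists:
  assumes Q: "Q a b c d" and pos: "a > 0" "b > 0" and "c = 0 \<Longrightarrow> b \<le> d" "d = 0 \<Longrightarrow> a \<le> c"
  shows narrow
proof (cases "b + d > 6")
  case True
  have nn: "c \<ge> 0" "d \<ge> 0" and ac: "a + c \<le> 1" using nonneg[OF Q] box_1_6[OF Q] True by auto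
  consider "c > 0" | "c = 0" "d \<le> 6" | "c = 0" "d > 6" using nn by linarith
  then show ?thesis
  proof cases
    case 1
    then show ?thesis using narrow_by_forward[OF Q] True pos by blast
  next
    case 2
    then show ?thesis using narrowI[OF Q] ac assms by auto
  next
    case 3
    then show ?thesis using narrow_by_forward[OF forward'[OF Q]] assms by auto
  qed
next
  case False
  have nn: "c \<ge> 0" "d \<ge> 0" using nonneg[OF Q] by auto
  show ?thesis
  proof (cases "d = 0")
    case True
    have Q': "Q a b (c - a) b" using backward'[OF Q] True assms by simp
    show ?thesis
    proof (cases "b + b \<le> 6")
      case True
      then show ?thesis using narrow_by_backward[OF Q'] pos by blast
    next
      case False
      then show ?thesis using narrowI[OF Q'] box_1_6[OF Q'] \<open>\<not> b + d > 6\<close> nn by auto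
    qed
  next
    case d: False
    then show ?thesis using narrow_by_backward[OF Q] False pos nn by auto
  qed
qed

text \<open>The ratio d/b, split at 1/4, 1/3, 1/2, 2/3 and 3/4, determines the order of the
  Euclidean steps. Along each chain some box becomes too wide and too tall for one of the
  rectangles, or the forced bounds make the determinant too small.\<close>

lemma det_le_5_aux:
  assumes Q: "Q a b c d" and ac: "a + c \<le> 1" and bd: "d \<le> b" "b \<le> 6"
  shows "D \<le> 5"
proof (rule ccontr)
  assume "\<not> D \<le> 5"
  then have D: "a * d + b * c > 5" using det[OF Q] by simp
  have nn: "0 \<le> a" "0 \<le> b" "0 \<le> c" "0 \<le> d" using nonneg[OF Q] by auto
  \<comment> \<open>Numerical bounds on \<open>d\<close> and \<open>b\<close> make the bilinear
    determinant condition linear in \<open>a\<close> and \<open>c\<close>.\<close>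
  have D_le: "5 < a * k + l * c" if "d \<le> k" "b \<le> l" for k l
    using D mult_left_mono[OF that(1) nn(1)] mult_right_mono[OF that(2) nn(3)] by linarith
  have "b * (a + c) \<le> b * 1" using ac nn by (intro mult_left_mono) auto
  then have b5: "b > 5" using D_le[of b b] bd by (simp add: algebra_simps)
  have ac': "a + c > 5/6" using D_le[of 6 6] bd by simp
  note Q1 = forward[OF Q bd(1)]
  consider "b \<le> 2 * d" "d > 4" | "b \<le> 2 * d" "d \<le> 4" "3 * d \<le> 2 * b"
    | "b \<le> 2 * d" "d \<le> 4" "2 * b \<le> 3 * d" "4 * d \<le> 3 * b"
    | "b \<le> 2 * d" "d \<le> 4" "3 * b \<le> 4 * d"
    | "2 * d \<le> b" "b \<le> 3 * d" | "3 * d \<le> b" "b \<le> 4 * d" | "4 * d \<le> b"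
    by linarith
  then show False
  proof cases
    case 1
    have Q2: "Q (a + c) (b - d) (a + 2*c) (2*d - b)"
      using forward'[OF Q1] 1 by (simp add: algebra_simps)
    have W: "2 * a + 3 * c \<le> 2" using box_2_4[OF Q2] 1 by auto
    \<comment> \<open>As d \<ge> 4, 6c \<le> (3/2)cd, so ad + bc \<le> (a + (3/2)c)d \<le>
      d.\<close>
    have "(2 * a + 3 * c) * d \<le> 2 * d" "b * c \<le> 6 * c" "4 * c \<le> d * c"
      using W bd nn 1 by (intro mult_right_mono; simp)+
    then have d5: "d > 5" using D by (simp add: algebra_simps)
    have "Q (a + c) (b - d) (2*a + 3*c) (3*d - 2*b)"
      using forward'[OF Q2] bd d5 by (simp add: algebra_simps)
    from box_2_4[OF this] show False using bd d5 ac' nn by auto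
  next
    case 2
    have Q2: "Q (a + c) (b - d) (a + 2*c) (2*d - b)"
      using forward'[OF Q1] 2 by (simp add: algebra_simps)
    have Q3: "Q (2*a + 3*c) (2*b - 3*d) (a + 2*c) (2*d - b)"
      using forward[OF Q2] 2 by (simp add: algebra_simps)
    have D46: "5 < a * 4 + 6 * c" using D_le[of 4 6] 2 bd by simp
    \<comment> \<open>The width of the box of \<open>Q3\<close> is 3a + 5c = (4a + 6c) - (a + c) >
      4.\<close>
    have H: "b - d \<le> 2" using box_4_2[OF Q3] D46 ac by auto
    have Q4: "Q (2*a + 3*c) (2*b - 3*d) (3*a + 5*c) (5*d - 3*b)"
      using forward'[OF Q3] 2 H b5 by (simp add: algebra_simps)
    from box_6_1[OF Q4] show False using D46 ac H b5 by auto
  next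
    case 3
    have Q2: "Q (a + c) (b - d) (a + 2*c) (2*d - b)"
      using forward'[OF Q1] 3 by (simp add: algebra_simps)
    have Q3: "Q (a + c) (b - d) (2*a + 3*c) (3*d - 2*b)"
      using forward'[OF Q2] 3 by (simp add: algebra_simps)
    have Q4: "Q (3*a + 4*c) (3*b - 4*d) (2*a + 3*c) (3*d - 2*b)"
      using forward[OF Q3] 3 by (simp add: algebra_simps)
    have W: "5*a + 7*c \<le> 6" using box_6_1[OF Q4] 3 b5 by auto
    have D46: "5 < a * 4 + 6 * c" using D_le[of 4 6] 3 bd by simp
    \<comment> \<open>With d \<le> 4, the branches give b \<le> (1 + 4 * 4)/3 = 17/3 and b < 7 * 4/5
      = 28/5; either one contradicts \<open>W\<close>.\<close>
    show False
    proof (cases "7 * d \<le> 5 * b")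
      case True
      have Q5: "Q (5*a + 7*c) (5*b - 7*d) (2*a + 3*c) (3*d - 2*b)"
        using forward[OF Q4] True by (simp add: algebra_simps)
      have "3*b - 4*d \<le> 1" using box_6_1[OF Q5] D46 ac ac' by auto
      then show False using D_le[of 4 "17/3"] 3 W ac nn by auto
    next
      case False
      then show False using D_le[of 4 "28/5"] 3 W ac by auto
    qed
  next
    case 4
    have Q2: "Q (a + c) (b - d) (a + 2*c) (2*d - b)"
      using forward'[OF Q1] 4 by (simp add: algebra_simps)
    have Q3: "Q (a + c) (b - d) (2*a + 3*c) (3*d - 2*b)"
      using forward'[OF Q2] 4 nn by (simp add: algebra_simps)
    have Q4: "Q (a + c) (b - d) (3*a + 4*c) (4*d - 3*b)"
      using forward'[OF Q3] 4 by (simp add: algebra_simps)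
    have Q5: "Q (4*a + 5*c) (4*b - 5*d) (3*a + 4*c) (4*d - 3*b)"
      using forward[OF Q4] 4 b5 by (simp add: algebra_simps)
    have "5 < a * 4 + 6 * c" using D_le[of 4 6] 4 bd by simp
    then show False using box_6_1[OF Q5] 4 b5 ac ac' by auto
  next
    case 5
    have Q2: "Q (a + 2*c) (b - 2*d) c d"
      using forward[OF Q1] 5 by (simp add: algebra_simps)
    have Q3: "Q (a + 2*c) (b - 2*d) (a + 3*c) (3*d - b)"
      using forward'[OF Q2] 5 by (simp add: algebra_simps)
    have "5 < a * 3 + 6 * c" using D_le[of 3 6] 5 bd by simp
    then have d2: "d \<le> 2" using box_4_2[OF Q3] ac by auto
    have Q4: "Q (2*a + 5*c) (2*b - 5*d) (a + 3*c) (3*d - b)"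
      using forward[OF Q3] d2 b5 by (simp add: algebra_simps)
    have "5 < a * 2 + 6 * c" using D_le[of 2 6] d2 bd by simp
    then show False using box_6_1[OF Q4] d2 b5 ac ac' by auto
  next
    case 6
    have Q2: "Q (a + 2*c) (b - 2*d) c d"
      using forward[OF Q1] 6 nn by (simp add: algebra_simps)
    have Q3: "Q (a + 3*c) (b - 3*d) c d"
      using forward[OF Q2] 6 by (simp add: algebra_simps)
    have Q4: "Q (a + 3*c) (b - 3*d) (a + 4*c) (4*d - b)"
      using forward'[OF Q3] 6 by (simp add: algebra_simps)
    have D26: "5 < a * 2 + 6 * c" using D_le[of 2 6] 6 bd by simp
    have H: "b - d \<le> 4" using box_2_4[OF Q2] D26 ac ac' by auto
    have W: "2*a + 7*c \<le> 6" using box_6_1[OF Q4] H b5 by auto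
    \<comment> \<open>With b \<le> d + 4, the branches give d \<le> 8/5, b \<le> 28/5 and d \<le>
      5/3, b \<le> 17/3.\<close>
    show False
    proof (cases "7 * d \<le> 2 * b")
      case True
      then show False using D_le[of "8/5" "28/5"] H W ac by auto
    next
      case False
      have Q5: "Q (a + 3*c) (b - 3*d) (2*a + 7*c) (7*d - 2*b)"
        using forward'[OF Q4] False by (simp add: algebra_simps)
      have "4*d - b \<le> 1" using box_6_1[OF Q5] D26 ac ac' by auto
      then show False using D_le[of "5/3" "17/3"] H W ac nn by auto
    qed
  next
    case 7
    have Q2: "Q (a + 2*c) (b - 2*d) c d"
      using forward[OF Q1] 7 nn by (simp add: algebra_simps)
    have Q3: "Q (a + 3*c) (b - 3*d) c d"
      using forward[OF Q2] 7 nn by (simp add: algebra_simps)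
    have Q4: "Q (a + 4*c) (b - 4*d) c d"
      using forward[OF Q3] 7 by (simp add: algebra_simps)
    have D26: "5 < a * 2 + 6 * c" using D_le[of 2 6] 7 bd by simp
    have H: "b - d \<le> 4" using box_2_4[OF Q2] D26 ac ac' by auto
    have Q5: "Q (a + 4*c) (b - 4*d) (a + 5*c) (5*d - b)"
      using forward'[OF Q4] H b5 by (simp add: algebra_simps)
    from box_6_1[OF Q5] show False using D26 ac H b5 by auto
  qed
qed

lemma det_le_5:
  assumes narrow
  shows "D \<le> 5"
proof -
  obtain a b c d where Q: "Q a b c d" "a + c \<le> 1" "b \<le> 6" "d \<le> 6"
    using assms unfolding narrow_def by blast
  show ?thesis
  proof (cases "d \<le> b")
    case True
    then show ?thesis using det_le_5_aux Q by blast
  next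
    case False
    then show ?thesis using det_le_5_aux[OF swap[OF Q(1)]] Q by simp
  qed
qed

end

lemma piercing_lattice_det_le_5:
  assumes F: "{(1, 6), (2, 4), (4, 2), (6, 1)} \<subseteq> F"
    and indep: "det2 u v \<noteq> 0" and pierce: "piercing F (lattice u v)"
  shows "\<bar>det2 u v\<bar> \<le> 5"
proof -
  interpret quad_chain "quad_basis (lattice u v) \<bar>det2 u v\<bar>" "\<bar>det2 u v\<bar>"
  proof
    fix a b c d assume Q: "quad_basis (lattice u v) \<bar>det2 u v\<bar> a b c d"
    then show nn: "0 \<le> a \<and> 0 \<le> b \<and> 0 \<le> c \<and> 0 \<le> d" and "a * d + b * c = \<bar>det2 u v\<bar>"
      by (auto simp: quad_basis_def)
    show "quad_basis (lattice u v) \<bar>det2 u v\<bar> c d a b" using Q by (rule quad_basis_swap)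
    show "quad_basis (lattice u v) \<bar>det2 u v\<bar> (a + c) (b - d) c d" if "d \<le> b"
      using quad_basis_shear[OF Q, of 1] that nn by simp
    show "quad_basis (lattice u v) \<bar>det2 u v\<bar> (a - c) (b + d) c d" if "c \<le> a"
      using quad_basis_shear[OF Q, of "-1"] that nn by simp
    show "a + c \<le> 1 \<or> b + d \<le> 6" "a + c \<le> 2 \<or> b + d \<le> 4"
      "a + c \<le> 4 \<or> b + d \<le> 2" "a + c \<le> 6 \<or> b + d \<le> 1"
      using quad_basis_empty_box[OF Q pierce] F by auto
  qed
  show ?thesis
    using quad_basis_exists[OF indep] narrow_exists det_le_5 by metis
qed

section \<open>A periodic piercing set\<close>

definition cells :: "(int \<times> int) list" where
  "cells = [(0, 0), (1, 3), (2, 5), (3, 1), (4, 4), (5, 2)]"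

definition pattern :: "(real \<times> real) set" where
  "pattern = {(of_int x, of_int y) | x y. (x mod 6, y mod 6) \<in> set cells}"

text \<open>By periodicity only the residues of the corner matter; ranging over lists makes the
  condition executable.\<close>

definition hits :: "int \<Rightarrow> int \<Rightarrow> bool" where
  "hits w h \<longleftrightarrow> (\<forall>x\<in>set [0..5]. \<forall>y\<in>set [0..5]. \<exists>i\<in>set [0..w - 1]. \<exists>j\<in>set [0..h - 1].
     ((x + i) mod 6, (y + j) mod 6) \<in> set cells)"

text \<open>Residues in cyclically adjacent columns differ by 2 or 3 modulo 6, so two such columns
  leave cyclic gaps of at most 4. The permutation is an involution, so exchanging the coordinates
  preserves the pattern.\<close>

lemma hits_rectangles: "hits 1 6" "hits 2 4" "hits 4 2" "hits 6 1"
  by code_simp+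

lemma pattern_meets_translate:
  assumes "hits w h" and "of_int w \<le> fst R" and "of_int h \<le> snd R"
  shows "\<exists>p\<in>pattern. p \<in> rect_translate R t"
proof -
  \<comment> \<open>Rounding the corner up loses less than 1, and \<open>w\<close> consecutive
    integers span only w - 1, so the block still fits.\<close>
  define x where "x = \<lceil>fst t\<rceil>"
  define y where "y = \<lceil>snd t\<rceil>"
  have "x mod 6 \<in> set [0..5]" "y mod 6 \<in> set [0..5]"
    using pos_mod_bound[of 6 x] pos_mod_bound[of 6 y] by auto
  then obtain i j where ij: "i \<in> {0..w - 1}" "j \<in> {0..h - 1}"
      "((x mod 6 + i) mod 6, (y mod 6 + j) mod 6) \<in> set cells"
    using assms(1) unfolding hits_def set_upto by meson
  then have "((x + i) mod 6, (y + j) mod 6) \<in> set cells" by (simp add: mod_simps)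
  then have "(of_int (x + i), of_int (y + j)) \<in> pattern"
    unfolding pattern_def by blast
  moreover have "fst t \<le> x" "x < fst t + 1" "snd t \<le> y" "y < snd t + 1"
    unfolding x_def y_def by linarith+
  moreover have "0 \<le> real_of_int i" "real_of_int i \<le> w - 1" "0 \<le> real_of_int j" "real_of_int j \<le> h - 1"
    using ij by auto
  ultimately show ?thesis
    using assms(2,3) by (intro bexI[of _ "(of_int (x + i), of_int (y + j))"])
      (auto simp: rect_translate_def)
qed

text \<open>Each column has one point per block of six rows, so a point is determined by its column
  and block. The summands 1 and 2 allow for incomplete columns and blocks at the boundary.\<close>

lemma ecard_pattern_le:
  assumes "r \<ge> 0"
  shows "ecard (pattern \<inter> ({-r..r} \<times> {-r..r})) \<le> ereal ((2 * r + 1) * (r / 3 + 2))"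
proof -
  define A where "A = {\<lceil>-r\<rceil>..\<lfloor>r\<rfloor>} \<times> {\<lfloor>-r / 6\<rfloor>..\<lfloor>r / 6\<rfloor>}"
  define S where "S = pattern \<inter> ({-r..r} \<times> {-r..r})"
  define f where "f = (\<lambda>p :: real \<times> real. (\<lfloor>fst p\<rfloor>, \<lfloor>snd p\<rfloor> div 6))"
  have inj: "inj_on f S"
  proof (rule inj_onI)
    fix p q assume pq: "p \<in> S" "q \<in> S" "f p = f q"
    obtain x y where p: "p = (of_int x, of_int y)" "(x mod 6, y mod 6) \<in> set cells"
      using pq(1) by (auto simp: S_def pattern_def)
    obtain x' y' where q: "q = (of_int x', of_int y')" "(x' mod 6, y' mod 6) \<in> set cells"
      using pq(2) by (auto simp: S_def pattern_def)
    have eq: "x = x'" "y div 6 = y' div 6" using pq(3) by (auto simp: f_def p q)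
    then have "y mod 6 = y' mod 6" using p(2) q(2) by (auto simp: cells_def)
    then show "p = q" using eq p(1) q(1) by (metis mult_div_mod_eq)
  qed
  have "f ` S \<subseteq> A"
  proof
    fix z assume "z \<in> f ` S"
    then obtain x y :: int where z: "z = (x, y div 6)"
        and xy: "-r \<le> x" "x \<le> r" "-r \<le> y" "y \<le> r"
      by (auto simp: S_def pattern_def f_def)
    have "\<lfloor>-r / 6\<rfloor> \<le> \<lfloor>real_of_int y / 6\<rfloor>" "\<lfloor>real_of_int y / 6\<rfloor> \<le> \<lfloor>r / 6\<rfloor>"
      using xy by (intro floor_mono; simp)+
    moreover have "\<lfloor>real_of_int y / 6\<rfloor> = y div 6"
      using floor_divide_of_int_eq[of y 6] by simp
    ultimately show "z \<in> A" using xy by (auto simp: A_def z le_floor_iff ceiling_le_iff)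
  qed
  moreover have "finite A" by (simp add: A_def)
  ultimately have fin: "finite S" and "card S \<le> card A"
    using inj inj_on_finite card_inj_on_le by blast+
  have "card A = nat (\<lfloor>r\<rfloor> - \<lceil>-r\<rceil> + 1) * nat (\<lfloor>r / 6\<rfloor> - \<lfloor>-r / 6\<rfloor> + 1)"
    by (simp add: A_def card_cartesian_product algebra_simps)
  moreover have "real (nat (\<lfloor>r\<rfloor> - \<lceil>-r\<rceil> + 1)) \<le> 2 * r + 1"
    using assms by linarith
  moreover have "real (nat (\<lfloor>r / 6\<rfloor> - \<lfloor>-r / 6\<rfloor> + 1)) \<le> r / 3 + 2"
    using assms by linarith
  ultimately have "real (card A) \<le> (2 * r + 1) * (r / 3 + 2)"
    using assms by (auto intro!: mult_mono)
  then have "real (card S) \<le> (2 * r + 1) * (r / 3 + 2)"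
    using \<open>card S \<le> card A\<close> by linarith
  then show ?thesis using fin by (simp add: ecard_def S_def)
qed

lemma density_pattern_le: "density pattern \<le> ereal (1 / 6)"
proof -
  let ?g = "\<lambda>r::real. (2 * r + 1) * (r / 3 + 2) / (2 * r)\<^sup>2"
  have "(?g \<longlongrightarrow> 1 / 6) at_top" by real_asymp
  then have lim: "((\<lambda>r. ereal (?g r)) \<longlongrightarrow> ereal (1 / 6)) at_top" by simp
  have "density pattern \<le> Limsup at_top (\<lambda>r. ereal (?g r))"
    unfolding density_def
  proof (rule Limsup_mono)
    show "\<forall>\<^sub>F r in at_top. ecard (pattern \<inter> ({-r..r} \<times> {-r..r})) / ereal ((2 * r)\<^sup>2) \<le> ereal (?g r)"
      using eventually_gt_at_top[of 0]
    proof eventually_elim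
      case (elim r)
      have "ecard (pattern \<inter> ({-r..r} \<times> {-r..r})) / ereal ((2 * r)\<^sup>2)
          \<le> ereal ((2 * r + 1) * (r / 3 + 2)) / ereal ((2 * r)\<^sup>2)"
        using elim by (intro ereal_divide_right_mono ecard_pattern_le) auto
      then show ?case using elim by simp
    qed
  qed
  also have "\<dots> = ereal (1 / 6)"
    using lim by (intro lim_imp_Limsup) auto
  finally show ?thesis .
qed

theorem theorem7:
  fixes n :: nat
  assumes "n \<ge> 5"
  shows "\<exists>F. finite F \<and> card F = n \<and> (\<forall>R\<in>F. is_rect R) \<and>
             pi_lat F \<ge> ereal (6/5) * pi_dens F"
proof -
  define C :: "(real \<times> real) set" where "C = {(1, 6), (2, 4), (4, 2), (6, 1)}"
  \<comment> \<open>Both sides are at least 6, which keeps these rectangles out of \<open>C\<close>;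
    the varying widths keep them distinct.\<close>
  define E :: "(real \<times> real) set" where "E = (\<lambda>k. (6 + real k, 6)) ` {..<n - 4}"
  define F where "F = C \<union> E"
  have fin: "finite C" "finite E" by (auto simp: C_def E_def)
  have "C \<inter> E = {}" by (auto simp: C_def E_def)
  moreover have "card E = n - 4" unfolding E_def by (subst card_image) (auto simp: inj_on_def)
  moreover have "card C = 4" by (simp add: C_def)
  ultimately have "card F = n" using fin assms by (simp add: F_def card_Un_disjoint)
  moreover have "\<forall>R\<in>F. is_rect R" by (auto simp: F_def C_def E_def is_rect_def)
  moreover have "pi_lat F \<ge> ereal (6/5) * pi_dens F"
  proof -
    have "piercing F pattern"
      unfolding piercing_def
    proof (intro ballI allI)
      fix R t assume "R \<in> F"
      then have "\<exists>w h. hits w h \<and> of_int w \<le> fst R \<and> of_int h \<le> snd R"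
        using hits_rectangles by (force simp: F_def C_def E_def)
      then show "\<exists>p\<in>pattern. p \<in> rect_translate R t"
        using pattern_meets_translate by blast
    qed
    then have "pi_dens F \<le> density pattern" unfolding pi_dens_def by (auto intro: Inf_lower)
    also have "\<dots> \<le> ereal (1 / 6)" by (rule density_pattern_le)
    finally have "ereal (6/5) * pi_dens F \<le> ereal (6/5) * ereal (1/6)"
      by (intro ereal_mult_left_mono) auto
    also have "\<dots> = ereal (1/5)" by simp
    also have "\<dots> \<le> pi_lat F"
      unfolding pi_lat_def
    proof (rule Inf_greatest, clarify)
      fix u v assume "det2 u v \<noteq> 0" "piercing F (lattice u v)"
      moreover from this have "\<bar>det2 u v\<bar> \<le> 5"
        by (intro piercing_lattice_det_le_5[of F]) (auto simp: F_def C_def)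
      ultimately show "ereal (1/5) \<le> ereal (1 / \<bar>det2 u v\<bar>)" by (simp add: field_simps)
    qed
    finally show ?thesis .
  qed
  ultimately show ?thesis using fin by (auto simp: F_def)
qed

end
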